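(* Let $a,b\ge 3$ be integers with $a<b$ such that $a$ and $b$ are both divisible by $4$ and at least one of $a/2$, $b/2$ is not a perfect square. Put $A=\{1,2,a\}$ and $B=\{1,2,b\}$. Then the Diophantine equation $P_A(x)=P_B(y)$ has infinitely many solutions $(x,y)$ in positive integers.
   Context: For a set $A$ of positive integers and a non-negative integer $n$, $P_A(n)$ denotes the number of partitions of $n$ into parts from $A$ (repetitions allowed, order of parts disregarded); $P_A(0)=1$. Equivalently, $\prod_{a\in A}\frac{1}{1-x^a}=\sum_{n=0}^\infty P_A(n)x^n$. *)

theory Defs
  imports Complex_Main "HOL-Library.Multiset"
begin

text \<open>
  A partition of \<open>n\<close> into parts from \<open>A\<close> is a finite multiset of elements of \<open>A\<close> with sum \<open>n\<close>.
  This is meant for sets \<open>A\<close> of positive integers: only \<open>0 \<notin> A\<close> guarantees that there are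
  finitely many such multisets, so that \<open>card\<close> really counts them.
\<close>

definition partitions_into :: "nat set \<Rightarrow> nat \<Rightarrow> nat multiset set" where
  "partitions_into A n = {M. set_mset M \<subseteq> A \<and> sum_mset M = n}"

definition num_partitions_into :: "nat set \<Rightarrow> nat \<Rightarrow> nat" where
  "num_partitions_into A n = card (partitions_into A n)"

lemma finite_partitions_into:
  assumes "0 \<notin> A"
  shows "finite (partitions_into A n)"
proof -
  have size_le: "size M \<le> sum_mset M" if "0 \<notin># M" for M :: "nat multiset"
    using that by (induction M) auto
  have "partitions_into A n \<subseteq> mset ` {xs. set xs \<subseteq> {..n} \<and> length xs \<le> n}"
  proof
    fix M assume M: "M \<in> partitions_into A n"
    obtain xs where xs: "M = mset xs" by (metis ex_mset)
    from M assms have "0 \<notin># M" and "sum_mset M = n"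
      by (auto simp: partitions_into_def)
    then have "length xs \<le> n" using size_le[of M] xs by simp
    moreover have "set xs \<subseteq> {..n}"
      using \<open>sum_mset M = n\<close> xs
      by (auto simp: sum_mset_sum_list intro: member_le_sum_list)
    ultimately show "M \<in> mset ` {xs. set xs \<subseteq> {..n} \<and> length xs \<le> n}"
      using xs by blast
  qed
  then show ?thesis
    by (rule finite_subset) (simp add: finite_lists_length_le)
qed

lemma num_partitions_into_0:
  assumes "0 \<notin> A"
  shows "num_partitions_into A 0 = 1"
proof -
  have "partitions_into A 0 = {{#}}"
  proof (rule set_eqI)
    fix M
    show "M \<in> partitions_into A 0 \<longleftrightarrow> M \<in> {{#}}"
      using assms by (cases M) (auto simp: partitions_into_def)
  qed
  then show ?thesis by (simp add: num_partitions_into_def)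
qed

end

theory Submission
  imports Defs "HOL-Analysis.Kronecker_Approximation_Theorem"
begin

text \<open>
  Write \<open>a = 4c\<close> and \<open>b = 4d\<close>. Peeling off parts equal to \<open>a\<close> gives
  \<open>P\<^sub>A (4c q + 2r) = (q + 1) (c q + r + 1)\<close> for \<open>r < 2c\<close>, so with \<open>Q = q + 1\<close> the function \<open>P\<^sub>A\<close> takes
  the values \<open>c Q\<^sup>2\<close> (from \<open>r = c - 1\<close>) and \<open>Q (c Q + 1)\<close> (from \<open>r = c\<close>). If \<open>c d = s\<^sup>2\<close>, then
  \<open>c Q\<^sup>2 = d R\<^sup>2\<close> is solved by \<open>Q = s k\<close>, \<open>R = c k\<close>. Otherwise every solution of the Pell equation
  \<open>x\<^sup>2 = c d y\<^sup>2 + 1\<close> gives \<open>Q (c Q + 1) = d R\<^sup>2\<close> with \<open>Q = d y\<^sup>2\<close>, \<open>R = x y\<close>.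
\<close>

section \<open>Counting partitions by peeling off one part\<close>

lemma partitions_into_insert:
  assumes "a \<notin> A"
  shows "partitions_into (insert a A) n =
    partitions_into A n \<union>
    (if a \<le> n then add_mset a ` partitions_into (insert a A) (n - a) else {})"
    (is "?L = ?R")
proof (intro equalityI subsetI)
  fix M assume M: "M \<in> ?L"
  show "M \<in> ?R"
  proof (cases "a \<in># M")
    case True
    then obtain M' where "M = add_mset a M'"
      by (metis insert_DiffM)
    with M show ?thesis
      by (auto simp: partitions_into_def)
  next
    case False
    with M show ?thesis
      by (auto simp: partitions_into_def)
  qed
qed (auto simp: partitions_into_def split: if_splits)

text \<open>As \<open>a \<notin> A\<close>, multisets without and with \<open>a\<close> are disjoint
  classes, and adding \<open>a\<close> is injective. The guard \<open>a \<le> n\<close> matters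
  because \<open>n - a\<close> truncates at 0.\<close>

lemma num_partitions_into_insert:
  assumes "a \<notin> A" and "0 \<notin> insert a A"
  shows "num_partitions_into (insert a A) n =
    num_partitions_into A n +
    (if a \<le> n then num_partitions_into (insert a A) (n - a) else 0)"
proof -
  have "partitions_into A n \<inter> add_mset a ` X = {}" for X
    using assms(1) by (auto simp: partitions_into_def)
  moreover have "finite (partitions_into A n)" "finite (partitions_into (insert a A) (n - a))"
    using assms(2) by (auto intro!: finite_partitions_into)
  ultimately show ?thesis
    unfolding num_partitions_into_def
    by (subst partitions_into_insert[OF assms(1)]) (simp add: card_Un_disjoint card_image inj_on_def)
qed

lemma num_partitions_into_1: "num_partitions_into {1} n = 1"
proof (induction n)
  case (Suc n)
  have "num_partitions_into {} (Suc n) = 0"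
    by (auto simp: num_partitions_into_def partitions_into_def)
  with Suc show ?case
    using num_partitions_into_insert[of 1 "{}" "Suc n"] by simp
qed (simp add: num_partitions_into_0)

lemma num_partitions_into_1_2: "num_partitions_into {1, 2} (2 * n) = n + 1"
proof (induction n)
  case (Suc n)
  with num_partitions_into_insert[of 2 "{1}" "2 * Suc n"] show ?case
    by (simp add: insert_commute num_partitions_into_1[simplified])
qed (simp add: num_partitions_into_0)

text \<open>Removing a part \<open>4 * c\<close> lowers \<open>q\<close> by one, and
  \<open>2 * c * j + r + 1\<close> partitions at level \<open>j\<close> avoid that part; summing
  this progression over \<open>j \<le> q\<close> gives the product. As \<open>r < 2 * c\<close>, no
  part \<open>4 * c\<close> fits at level 0.\<close>

lemma num_partitions_into_1_2_4c:
  assumes "r < 2 * c"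
  shows "num_partitions_into {1, 2, 4 * c} (4 * c * q + 2 * r) = (q + 1) * (c * q + r + 1)"
proof -
  have step: "num_partitions_into {1, 2, 4 * c} (2 * n) = n + 1 +
      (if 4 * c \<le> 2 * n then num_partitions_into {1, 2, 4 * c} (2 * n - 4 * c) else 0)" for n
  proof -
    have "4 * c \<notin> {1, 2}" "0 \<notin> {4 * c, 1, 2}" using assms by auto
    moreover have "insert (4 * c) {1, 2} = {1, 2, 4 * c}" by auto
    ultimately show ?thesis
      using num_partitions_into_insert[of "4 * c" "{1, 2}" "2 * n"]
      by (simp only: num_partitions_into_1_2 simp_thms)
  qed
  show ?thesis
  proof (induction q)
    case 0
    then show ?case using step[of r] assms by simp
  next
    case (Suc q)
    have "4 * c * Suc q + 2 * r = 2 * (2 * c * Suc q + r)" by simp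
    moreover have "2 * (2 * c * Suc q + r) - 4 * c = 4 * c * q + 2 * r" by simp
    moreover have "4 * c \<le> 2 * (2 * c * Suc q + r)" by simp
    ultimately have "num_partitions_into {1, 2, 4 * c} (4 * c * Suc q + 2 * r) =
        2 * c * Suc q + r + 1 + num_partitions_into {1, 2, 4 * c} (4 * c * q + 2 * r)"
      using step[of "2 * c * Suc q + r"] by (simp add: mult.assoc)
    with Suc show ?case
      by (simp add: algebra_simps)
  qed
qed

lemma num_partitions_into_1_2_4c_attains:
  assumes "c > 0" and "Q > 0" and "t \<le> 1"
  obtains x where "Q \<le> x + 1" and "num_partitions_into {1, 2, 4 * c} x = Q * (c * Q + t)"
proof -
  obtain q where q: "Q = Suc q" using assms(2) by (cases Q) auto
  obtain e where e: "c = Suc e" using assms(1) by (cases c) auto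
  \<comment> \<open>The choice \<open>r = c - 1 + t\<close>, with \<open>e\<close> for
    \<open>c - 1\<close>, turns \<open>c * q + r + 1\<close> into \<open>c * Q + t\<close>;
    \<open>t \<le> 1\<close> keeps \<open>r < 2 * c\<close>.\<close>
  let ?x = "4 * c * q + 2 * (e + t)"
  have "q \<le> 4 * c * q" using assms(1) by simp
  then have "Q \<le> ?x + 1" using q by linarith
  moreover have "num_partitions_into {1, 2, 4 * c} ?x = Q * (c * Q + t)"
    using num_partitions_into_1_2_4c[of "e + t" c q] assms(3) q e
    by (simp add: algebra_simps)
  ultimately show ?thesis by (rule that)
qed

section \<open>Pell's equation via Diophantine approximation\<close>

lemma sqrt_nat_irrational:
  fixes D :: nat
  assumes "\<nexists>k. D = k\<^sup>2"
  shows "sqrt D \<notin> \<rat>"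
proof
  assume "sqrt D \<in> \<rat>"
  then obtain m n :: nat where n: "n \<noteq> 0" and eq: "\<bar>sqrt D\<bar> = m / n" and "coprime m n"
    by (rule Rats_abs_nat_div_natE)
  have "real D = (real m / real n)\<^sup>2"
    by (metis eq power2_abs real_sqrt_pow2 of_nat_0_le_iff)
  then have "real (D * n\<^sup>2) = real (m\<^sup>2)"
    using n by (simp add: field_simps)
  then have *: "D * n\<^sup>2 = m\<^sup>2"
    by (simp only: of_nat_eq_iff)
  then have "n\<^sup>2 dvd m\<^sup>2" by (metis dvd_triv_right)
  then have "n dvd m" by simp
  with \<open>coprime m n\<close> have "n = 1"
    by (metis coprime_absorb_right nat_dvd_1_iff_1)
  with * assms show False by simp
qed

text \<open>Factor the norm as \<open>(h - k * sqrt D) * (h + k * sqrt D)\<close>. The first factor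
  is below \<open>1 / k\<close> in absolute value and the second is larger by at most
  \<open>2 * k * sqrt D\<close>, so the bound is independent of \<open>h\<close> and
  \<open>k\<close>.\<close>

lemma approx_set_sqrt_norm_bound:
  fixes D :: nat
  assumes "(h, k) \<in> approx_set (sqrt D)"
  shows "\<bar>h\<^sup>2 - int D * k\<^sup>2\<bar> \<le> \<lceil>1 + 2 * sqrt D\<rceil>"
proof -
  let ?s = "sqrt D"
  from assms have k: "k > 0" and lt: "\<bar>?s - h / k\<bar> < 1 / (real_of_int k)\<^sup>2"
    by (auto simp: approx_set_def)
  have "\<bar>?s - h / k\<bar> * k\<^sup>2 < 1"
    using lt k by (simp add: pos_less_divide_eq)
  moreover have "\<bar>?s - h / k\<bar> * k\<^sup>2 = \<bar>h - k * ?s\<bar> * k"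
  proof -
    have "\<bar>?s - h / k\<bar> * k = \<bar>(?s - h / k) * k\<bar>" using k by (simp add: abs_mult)
    also have "(?s - h / k) * k = - (h - k * ?s)" using k by (simp add: field_simps)
    finally show ?thesis by (simp add: power2_eq_square abs_minus_commute flip: mult.assoc)
  qed
  ultimately have 1: "\<bar>h - k * ?s\<bar> * k < 1" by simp
  have "\<bar>h - k * ?s\<bar> \<le> \<bar>h - k * ?s\<bar> * k"
    using k by (simp add: mult_le_cancel_left1)
  with 1 have 2: "\<bar>h - k * ?s\<bar> < 1" by simp
  have "\<bar>h + k * ?s\<bar> \<le> \<bar>h - k * ?s\<bar> + 2 * (k * ?s)"
    using k by (smt (verit) mult_nonneg_nonneg of_int_0_less_iff real_sqrt_ge_0_iff of_nat_0_le_iff)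
  then have "\<bar>h - k * ?s\<bar> * \<bar>h + k * ?s\<bar> \<le> \<bar>h - k * ?s\<bar> * (\<bar>h - k * ?s\<bar> + 2 * (k * ?s))"
    by (rule mult_left_mono) simp
  also have "\<dots> = \<bar>h - k * ?s\<bar> * \<bar>h - k * ?s\<bar> + (\<bar>h - k * ?s\<bar> * k) * (2 * ?s)"
    by (simp add: algebra_simps)
  also have "\<dots> \<le> 1 * 1 + 1 * (2 * ?s)"
    using 1 2 by (intro add_mono mult_mono) auto
  also have "\<bar>h - k * ?s\<bar> * \<bar>h + k * ?s\<bar> = \<bar>(h - k * ?s) * (h + k * ?s)\<bar>"
    by (simp add: abs_mult)
  also have "(h - k * ?s) * (h + k * ?s) = h\<^sup>2 - k\<^sup>2 * ?s\<^sup>2"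
    by (simp add: algebra_simps power2_eq_square)
  also have "\<dots> = of_int (h\<^sup>2 - int D * k\<^sup>2)" by simp
  finally show ?thesis by linarith
qed

text \<open>
  By pigeonhole, two distinct good approximations \<open>h / k\<close> have the same norm \<open>n\<close> and agree modulo \<open>n\<close>; their quotient
  in \<open>\<int>[\<surd>D]\<close> is then a nontrivial unit of norm 1.
\<close>

lemma Pell_nontrivial_solution:
  fixes D :: nat
  assumes nonsq: "\<nexists>k. D = k\<^sup>2"
  obtains x y :: nat where "y > 0" and "x\<^sup>2 = D * y\<^sup>2 + 1"
proof -
  define N where "N = (\<lambda>(h, k). h\<^sup>2 - int D * k\<^sup>2)"
  let ?S = "approx_set (sqrt D)"
  \<comment> \<open>Dirichlet: an irrational number has infinitely many such approximations, while
    their norms take only finitely many values.\<close>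
  have "infinite ?S"
    using rational_iff_finite_approx_set sqrt_nat_irrational[OF nonsq] by blast
  moreover have "N ` ?S \<subseteq> {- \<lceil>1 + 2 * sqrt D\<rceil>..\<lceil>1 + 2 * sqrt D\<rceil>}"
  proof
    fix v assume "v \<in> N ` ?S"
    then obtain h k where "(h, k) \<in> ?S" "v = h\<^sup>2 - int D * k\<^sup>2"
      by (auto simp: N_def)
    then show "v \<in> {- \<lceil>1 + 2 * sqrt D\<rceil>..\<lceil>1 + 2 * sqrt D\<rceil>}"
      using approx_set_sqrt_norm_bound[of h k D] by auto
  qed
  then have "finite (N ` ?S)"
    by (rule finite_subset) simp
  ultimately obtain p where p: "p \<in> ?S" and inf: "infinite {q \<in> ?S. N q = N p}"
    using pigeonhole_infinite by blast
  define n where "n = N p"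
  define T where "T = {q \<in> ?S. N q = n}"
  \<comment> \<open>Only a nonzero modulus leaves finitely many residues; norm 0 would make
    \<open>sqrt D\<close> rational.\<close>
  have n0: "n \<noteq> 0"
  proof
    obtain h k where hk: "p = (h, k)" by fastforce
    assume "n = 0"
    then have eq: "h\<^sup>2 = int D * k\<^sup>2" by (simp add: n_def N_def hk)
    from p hk have k: "k > 0" by (auto simp: approx_set_def)
    have "real D = (h / k)\<^sup>2"
    proof -
      have "(real_of_int h)\<^sup>2 = real D * (real_of_int k)\<^sup>2"
        using arg_cong[OF eq, of real_of_int] by simp
      then show ?thesis using k by (simp add: field_simps)
    qed
    then have "sqrt D = \<bar>real_of_int h / real_of_int k\<bar>" by simp
    then have "sqrt D \<in> \<rat>" by simp
    then show False using sqrt_nat_irrational[OF nonsq] by simp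
  qed
  define res where "res = (\<lambda>(h, k). (h mod n, k mod n))"
  have "res ` T \<subseteq> {- \<bar>n\<bar>..\<bar>n\<bar>} \<times> {- \<bar>n\<bar>..\<bar>n\<bar>}"
  proof -
    \<comment> \<open>The symmetric interval is due to \<open>mod\<close> taking the sign of
      \<open>n\<close>, which may be negative.\<close>
    have "m mod n \<in> {- \<bar>n\<bar>..\<bar>n\<bar>}" for m
      using abs_mod_less[OF n0, of m] by auto
    then show ?thesis by (auto simp: res_def)
  qed
  then have "finite (res ` T)"
    by (rule finite_subset) simp
  then obtain q where q: "q \<in> T" and "infinite {q' \<in> T. res q' = res q}"
    using pigeonhole_infinite inf unfolding T_def n_def by blast
  then have "{q' \<in> T. res q' = res q} - {q} \<noteq> {}"
    by (metis finite.emptyI infinite_remove)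
  then obtain q' where q': "q' \<in> T" "res q' = res q" "q' \<noteq> q"
    by blast
  obtain h k where hk: "q = (h, k)" by fastforce
  obtain h' k' where hk': "q' = (h', k')" by fastforce
  have norm: "h\<^sup>2 - int D * k\<^sup>2 = n" and norm': "h'\<^sup>2 - int D * k'\<^sup>2 = n"
    using q q' hk hk' by (auto simp: T_def N_def)
  have pos: "k > 0" "k' > 0" and cop: "coprime h k" "coprime h' k'"
    using q q' hk hk' by (auto simp: T_def approx_set_def)
  have "n dvd h' - h" "n dvd k' - k"
    using q' hk hk' by (auto simp: res_def mod_eq_dvd_iff)
  then obtain u v where u: "h' = h + n * u" and v: "k' = k + n * v"
    by (metis add.commute diff_add_cancel dvdE)
  \<comment> \<open>\<open>X + Y * sqrt D\<close> is the quotient of \<open>h + k * sqrt D\<close>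
    by \<open>h' + k' * sqrt D\<close>; the congruences modulo \<open>n\<close> make its coordinates
    integers.\<close>
  define X where "X = 1 + h * u - int D * k * v"
  define Y where "Y = k * u - h * v"
  have nX: "n * X = h * h' - int D * k * k'"
    unfolding X_def u v using norm by (simp add: algebra_simps power2_eq_square)
  have nY: "n * Y = h' * k - h * k'"
    unfolding Y_def u v by (simp add: algebra_simps)
  have "n\<^sup>2 * (X\<^sup>2 - int D * Y\<^sup>2) = (n * X)\<^sup>2 - int D * (n * Y)\<^sup>2"
    by (simp add: algebra_simps)
  \<comment> \<open>Brahmagupta's identity: the norm is multiplicative.\<close>
  also have "\<dots> = (h\<^sup>2 - int D * k\<^sup>2) * (h'\<^sup>2 - int D * k'\<^sup>2)"
    unfolding nX nY by (simp add: algebra_simps power2_eq_square)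
  also have "\<dots> = n\<^sup>2 * 1"
    unfolding norm norm' by (simp add: power2_eq_square)
  finally have pell: "X\<^sup>2 - int D * Y\<^sup>2 = 1"
    using n0 by simp
  \<comment> \<open>\<open>Y = 0\<close> would mean \<open>h / k = h' / k'\<close>; both are in
    lowest terms with positive denominators, so the two approximations would coincide.\<close>
  have "Y \<noteq> 0"
  proof
    assume "Y = 0"
    with nY have "h' * k = h * k'" by simp
    moreover from this have "k dvd k'" "k' dvd k"
      using cop by (metis coprime_commute coprime_dvd_mult_right_iff dvd_triv_right)+
    then have "k = k'" using pos by (simp add: zdvd_antisym_nonneg)
    ultimately show False using q'(3) hk hk' pos by simp
  qed
  show ?thesis
  proof
    show "nat \<bar>Y\<bar> > 0" using \<open>Y \<noteq> 0\<close> by simp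
    have "int ((nat \<bar>X\<bar>)\<^sup>2) = int (D * (nat \<bar>Y\<bar>)\<^sup>2 + 1)"
      using pell by simp
    then show "(nat \<bar>X\<bar>)\<^sup>2 = D * (nat \<bar>Y\<bar>)\<^sup>2 + 1"
      by (simp only: of_nat_eq_iff)
  qed
qed

text \<open>Squaring the unit \<open>x + y * sqrt D\<close> keeps norm 1 and replaces
  \<open>y\<close> by \<open>2 * x * y\<close>, which is at least \<open>2 * y\<close>.\<close>

lemma Pell_large_solution:
  fixes D N :: nat
  assumes "\<nexists>k. D = k\<^sup>2"
  shows "\<exists>x y. y > N \<and> x\<^sup>2 = D * y\<^sup>2 + 1"
proof (induction N)
  case 0
  show ?case using Pell_nontrivial_solution[OF assms] by metis
next
  case (Suc N)
  then obtain x y where y: "y > N" and eq: "x\<^sup>2 = D * y\<^sup>2 + 1" by blast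
  have "x \<noteq> 0" using eq by (cases "x = 0") auto
  then have "2 * x * y \<ge> 2 * y" by simp
  moreover have "(x\<^sup>2 + D * y\<^sup>2)\<^sup>2 = D * (2 * x * y)\<^sup>2 + 1"
  proof -
    have "D * (2 * x * y)\<^sup>2 = 4 * D * y\<^sup>2 * x\<^sup>2"
      by (simp add: power_mult_distrib)
    then show ?thesis
      unfolding eq by (simp add: algebra_simps power2_eq_square)
  qed
  ultimately show ?case
    using y by (intro exI[of _ "x\<^sup>2 + D * y\<^sup>2"] exI[of _ "2 * x * y"]) linarith
qed

section \<open>Matching large values of the two partition functions\<close>

lemma large_solution:
  fixes c d N :: nat
  assumes "c > 0" and "d > 0"
  obtains Q R t where "Q > N" and "R > N" and "t \<le> 1" and "Q * (c * Q + t) = R * (d * R)"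
proof (cases "\<exists>s. c * d = s\<^sup>2")
  case True
  then obtain s where s: "c * d = s\<^sup>2" by blast
  with assms have "s > 0" by (cases "s = 0") auto
  show ?thesis
  proof (rule that)
    show "s * Suc N > N" "c * Suc N > N"
      using \<open>s > 0\<close> assms(1) by (cases s; cases c; simp)+
    have "(s * Suc N) * (c * (s * Suc N) + 0) = c * (s\<^sup>2) * (Suc N)\<^sup>2"
      by (simp add: power2_eq_square algebra_simps)
    also have "\<dots> = (c * Suc N) * (d * (c * Suc N))"
      unfolding s[symmetric] by (simp only: power2_eq_square ac_simps)
    finally show "(s * Suc N) * (c * (s * Suc N) + 0) = (c * Suc N) * (d * (c * Suc N))" .
  qed simp
next
  case False
  then obtain x y where y: "y > N" and eq: "x\<^sup>2 = c * d * y\<^sup>2 + 1"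
    using Pell_large_solution by blast
  have "x > 0" using eq by (cases "x = 0") auto
  show ?thesis
  proof (rule that)
    have "y \<le> d * y\<^sup>2" using assms(2) by (simp add: power2_eq_square)
    with y show "d * y\<^sup>2 > N" by simp
    have "y \<le> x * y" using \<open>x > 0\<close> by simp
    with y show "x * y > N" by (rule less_le_trans)
    \<comment> \<open>The Pell equation turns the second factor,
      \<open>c * d * y\<^sup>2 + 1\<close>, into a square.\<close>
    have "(d * y\<^sup>2) * (c * (d * y\<^sup>2) + 1) = d * y\<^sup>2 * x\<^sup>2"
      unfolding eq by (simp add: algebra_simps)
    then show "(d * y\<^sup>2) * (c * (d * y\<^sup>2) + 1) = (x * y) * (d * (x * y))"
      by (simp add: power2_eq_square algebra_simps)
  qed simp
qed

theorem theorem4p5: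
  fixes a b :: nat and A B :: "nat set"
  assumes "a \<ge> 3" and "b \<ge> 3" and "a < b"
    and "4 dvd a" and "4 dvd b"
    and "(\<not> (\<exists>k::nat. a div 2 = k ^ 2)) \<or> (\<not> (\<exists>k::nat. b div 2 = k ^ 2))"
    and "A = {1, 2, a}" and "B = {1, 2, b}"
  shows "infinite {(x :: nat, y :: nat).
           x > 0 \<and> y > 0 \<and> num_partitions_into A x = num_partitions_into B y}"
    (is "infinite ?S")
proof -
  obtain c d where c: "a = 4 * c" and d: "b = 4 * d"
    using assms(4,5) unfolding dvd_def by blast
  with assms have pos: "c > 0" "d > 0" by auto
  have "\<exists>x>N. x \<in> fst ` ?S" for N
  proof -
    \<comment> \<open>The margin of 1 absorbs the loss in \<open>Q \<le> x + 1\<close> and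
      \<open>R \<le> y + 1\<close>, so that \<open>x\<close> and \<open>y\<close> exceed
      \<open>N\<close> and are positive.\<close>
    obtain Q R t where QR: "Q > N + 1" "R > N + 1" "t \<le> 1"
      and eq: "Q * (c * Q + t) = R * (d * R)"
      using large_solution[OF pos] by metis
    obtain x where x: "Q \<le> x + 1" "num_partitions_into A x = Q * (c * Q + t)"
      using num_partitions_into_1_2_4c_attains[of c Q t] pos QR c assms(7) by auto
    obtain y where y: "R \<le> y + 1" "num_partitions_into B y = R * (d * R)"
      using num_partitions_into_1_2_4c_attains[of d R 0] pos QR d assms(8) by auto
    have "(x, y) \<in> ?S" using x y eq QR by simp
    then have "x \<in> fst ` ?S" by (rule rev_image_eqI) simp
    moreover have "x > N" using x QR by simp
    ultimately show ?thesis by blast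
  qed
  then have "infinite (fst ` ?S)"
    unfolding infinite_nat_iff_unbounded by blast
  then show ?thesis using finite_imageI by blast
qed

end
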